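(* Let $A$ be a multigraded squarefree matrix over $R=\Bbbk[x_1,\ldots,x_n]$. Then $A$ is the presentation matrix of a multigraded squarefree $R$-module $M$.
   Context: $\Bbbk$ is a field of characteristic $0$, $R=\Bbbk[x_1,\ldots,x_n]$, $x^\alpha=x_1^{a_1}\cdots x_n^{a_n}$ and $\mathrm{supp}(\alpha)=\{i:a_i\ne0\}$ for $\alpha=(a_1,\dots,a_n)$. A vector is squarefree if it lies in $\{0,1\}^n$. An $s\times l$ matrix $A=(c_{ij}x^{\alpha_{ij}})$ with $c_{ij}\in\Bbbk$, $\alpha_{ij}\in\mathbb N^n$ is multigraded if every minor of $A$ equals $c\,x^{\alpha}$ for some $c\in\Bbbk$ (possibly $0$) and some $\alpha\in\mathbb N^n$. The system $E_A$ consists of the equations $\gamma_j-\beta_i=\alpha_{ij}$, one for each $(i,j)$ with $c_{ij}\ne0$, in the unknown vectors $\gamma_1,\ldots,\gamma_l,\beta_1,\ldots,\beta_s$. A multigraded matrix $A$ is squarefree if $E_A$ has a solution with all $\gamma_j,\beta_i\in\{0,1\}^n$. A multigraded module is an $R$-module $M=\bigoplus_{\alpha\in\mathbb N^n}M_\alpha$ with $\Bbbk x^{\alpha_1}\cdot M_{\alpha_2}\subset M_{\alpha_1+\alpha_2}$. A multigraded module $M$ has $A$ as a presentation matrix if there is an exact sequence $F_1\xrightarrow{\phi}F_0\to M\to0$ of multigraded modules and degree-preserving maps, with $F_1,F_0$ free with multigraded bases of sizes $l$ and $s$, with respect to which $\phi$ is represented by $A$. A finitely generated multigraded module $M$ is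 squarefree if for all $\alpha,\beta\in\mathbb N^n$ with $\mathrm{supp}(\beta)\subset\mathrm{supp}(\alpha)$ the map $M_\alpha\to M_{\alpha+\beta}$, $y\mapsto x^\beta y$, is a bijection. *)

theory Defs
  imports
    "HOL-Library.Poly_Mapping"
    "HOL-Algebra.AbelCoset"
    "Jordan_Normal_Form.VS_Connect"
    "Jordan_Normal_Form.DL_Submatrix"
begin

text \<open>The variables are indexed by the type \<open>'n\<close>, so for finite \<open>'n\<close> with \<open>n\<close> elements
  \<open>('n, 'k) mpoly\<close> is \<open>k[x\<^sub>1, \<dots>, x\<^sub>n]\<close>, with \<open>\<alpha> \<in> \<nat>\<^sup>n\<close> given as \<open>'n \<Rightarrow>\<^sub>0 nat\<close>,
  \<open>supp(\<alpha>)\<close> as \<open>Poly_Mapping.keys \<alpha>\<close>, and \<open>c x\<^sup>\<alpha>\<close> as \<open>Poly_Mapping.single \<alpha> c\<close>.\<close>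

type_synonym ('n, 'k) mpoly = "('n \<Rightarrow>\<^sub>0 nat) \<Rightarrow>\<^sub>0 'k"


section \<open>Multigraded and squarefree matrices\<close>

text \<open>The zero polynomial counts as a term, with coefficient \<open>0\<close>.\<close>

definition is_term :: "('n, 'k::field) mpoly \<Rightarrow> bool" where
  "is_term p \<longleftrightarrow> (\<exists>c \<alpha>. p = Poly_Mapping.single \<alpha> c)"

definition multigraded_matrix :: "('n, 'k::field) mpoly mat \<Rightarrow> bool" where
  "multigraded_matrix A \<longleftrightarrow>
     (\<forall>i < dim_row A. \<forall>j < dim_col A. is_term (A $$ (i, j))) \<and>
     (\<forall>I J. I \<subseteq> {..<dim_row A} \<and> J \<subseteq> {..<dim_col A} \<and> card I = card J \<longrightarrow>
        is_term (det (submatrix A I J)))"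

text \<open>The system \<open>E\<^sub>A\<close>. The unknowns are integer vectors, since subtraction on \<open>'n \<Rightarrow>\<^sub>0 nat\<close> is
  truncated; \<open>\<alpha>\<close> is determined by the entry because \<open>c \<noteq> 0\<close>.\<close>

definition solves_system ::
  "('n, 'k::field) mpoly mat \<Rightarrow> (nat \<Rightarrow> 'n \<Rightarrow> int) \<Rightarrow> (nat \<Rightarrow> 'n \<Rightarrow> int) \<Rightarrow> bool" where
  "solves_system A \<gamma> \<beta> \<longleftrightarrow>
     (\<forall>i < dim_row A. \<forall>j < dim_col A. \<forall>c \<alpha>.
        A $$ (i, j) = Poly_Mapping.single \<alpha> c \<and> c \<noteq> 0 \<longrightarrow>
        (\<forall>t. \<gamma> j t - \<beta> i t = int (Poly_Mapping.lookup \<alpha> t)))"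

definition squarefree_matrix :: "('n, 'k::field) mpoly mat \<Rightarrow> bool" where
  "squarefree_matrix A \<longleftrightarrow>
     multigraded_matrix A \<and>
     (\<exists>\<gamma> \<beta>. solves_system A \<gamma> \<beta> \<and>
        (\<forall>j < dim_col A. \<forall>t. \<gamma> j t \<in> {0, 1}) \<and>
        (\<forall>i < dim_row A. \<forall>t. \<beta> i t \<in> {0, 1}))"


section \<open>Multigraded modules\<close>

text \<open>A module together with its family of homogeneous components \<open>M\<^sub>\<alpha>\<close>.\<close>

record ('n, 'k, 'm) mgmodule = "(('n, 'k::zero) mpoly, 'm) module" +
  component :: "('n \<Rightarrow>\<^sub>0 nat) \<Rightarrow> 'm set"

text \<open>The second-to-last conjunct says that the module is the direct sum of its components; the last
  one with \<open>\<alpha> = 0\<close> makes the components \<open>k\<close>-subspaces.\<close>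

definition multigraded_module :: "('n, 'k::field, 'm) mgmodule \<Rightarrow> bool" where
  "multigraded_module M \<longleftrightarrow>
     Module.module (class_ring :: ('n, 'k) mpoly ring) M \<and>
     (\<forall>\<alpha>. additive_subgroup (component M \<alpha>) M) \<and>
     (\<forall>x \<in> carrier M. \<exists>!f. (\<forall>\<alpha>. f \<alpha> \<in> component M \<alpha>) \<and> finite {\<alpha>. f \<alpha> \<noteq> \<zero>\<^bsub>M\<^esub>} \<and>
        x = (\<Oplus>\<^bsub>M\<^esub>\<alpha> \<in> {\<alpha>. f \<alpha> \<noteq> \<zero>\<^bsub>M\<^esub>}. f \<alpha>)) \<and>
     (\<forall>c \<alpha> \<beta>. \<forall>x \<in> component M \<beta>.
        Poly_Mapping.single \<alpha> c \<odot>\<^bsub>M\<^esub> x \<in> component M (\<alpha> + \<beta>))"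

definition finitely_generated :: "('n, 'k::field, 'm) mgmodule \<Rightarrow> bool" where
  "finitely_generated M \<longleftrightarrow>
     (\<exists>S. finite S \<and> S \<subseteq> carrier M \<and>
        LinearCombinations.module.span (class_ring :: ('n, 'k) mpoly ring) M S = carrier M)"

definition squarefree_module :: "('n, 'k::field, 'm) mgmodule \<Rightarrow> bool" where
  "squarefree_module M \<longleftrightarrow>
     multigraded_module M \<and> finitely_generated M \<and>
     (\<forall>\<alpha> \<beta>. Poly_Mapping.keys \<beta> \<subseteq> Poly_Mapping.keys \<alpha> \<longrightarrow>
        bij_betw (\<lambda>y. Poly_Mapping.single \<beta> 1 \<odot>\<^bsub>M\<^esub> y) (component M \<alpha>) (component M (\<alpha> + \<beta>)))"


section \<open>Presentation matrices\<close>

definition multigraded_basis :: "('n, 'k::field, 'm) mgmodule \<Rightarrow> nat \<Rightarrow> (nat \<Rightarrow> 'm) \<Rightarrow> bool" where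
  "multigraded_basis F m e \<longleftrightarrow>
     (\<forall>i < m. \<exists>\<alpha>. e i \<in> component F \<alpha>) \<and>
     (\<forall>x \<in> carrier F. \<exists>!v. v \<in> carrier_vec m \<and> x = (\<Oplus>\<^bsub>F\<^esub>i \<in> {..<m}. (v $ i) \<odot>\<^bsub>F\<^esub> e i))"

definition degree_preserving_hom ::
  "('n, 'k::field, 'a) mgmodule \<Rightarrow> ('n, 'k, 'b) mgmodule \<Rightarrow> ('a \<Rightarrow> 'b) \<Rightarrow> bool" where
  "degree_preserving_hom M N f \<longleftrightarrow>
     f \<in> LinearCombinations.module_hom (class_ring :: ('n, 'k) mpoly ring) M N \<and>
     (\<forall>\<alpha>. f ` component M \<alpha> \<subseteq> component N \<alpha>)"

text \<open>Column \<open>j\<close> of \<open>A\<close> holds the coordinates of the image of the \<open>j\<close>-th basis element of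
  \<open>F\<^sub>1\<close>. The carriers of \<open>F\<^sub>0\<close>, \<open>F\<^sub>1\<close> are taken in the type of polynomial
  vectors; every free module with a finite basis has an isomorphic copy there.\<close>

definition has_presentation_matrix ::
  "('n, 'k::field, 'm) mgmodule \<Rightarrow> ('n, 'k) mpoly mat \<Rightarrow> bool" where
  "has_presentation_matrix M A \<longleftrightarrow>
     (\<exists>(F\<^sub>1 :: ('n, 'k, ('n, 'k) mpoly vec) mgmodule)
       (F\<^sub>0 :: ('n, 'k, ('n, 'k) mpoly vec) mgmodule) e\<^sub>1 e\<^sub>0 \<phi> \<pi>.
        multigraded_module F\<^sub>1 \<and> multigraded_module F\<^sub>0 \<and> multigraded_module M \<and>
        multigraded_basis F\<^sub>1 (dim_col A) e\<^sub>1 \<and> multigraded_basis F\<^sub>0 (dim_row A) e\<^sub>0 \<and>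
        degree_preserving_hom F\<^sub>1 F\<^sub>0 \<phi> \<and> degree_preserving_hom F\<^sub>0 M \<pi> \<and>
        (\<forall>j < dim_col A. \<phi> (e\<^sub>1 j) = (\<Oplus>\<^bsub>F\<^sub>0\<^esub>i \<in> {..<dim_row A}. A $$ (i, j) \<odot>\<^bsub>F\<^sub>0\<^esub> e\<^sub>0 i)) \<and>
        \<phi> ` carrier F\<^sub>1 = {x \<in> carrier F\<^sub>0. \<pi> x = \<zero>\<^bsub>M\<^esub>} \<and>
        \<pi> ` carrier F\<^sub>0 = carrier M)"

end

theory Submission
  imports Defs
begin

text \<open>A squarefree solution \<open>(\<gamma>, \<beta>)\<close> of the system \<open>E\<^sub>A\<close> makes \<open>A\<close> a degree-preserving map
  \<open>F\<^sub>1 \<rightarrow> F\<^sub>0\<close> between free modules with generators of degrees \<open>\<gamma>\<^sub>j\<close> and \<open>\<beta>\<^sub>i\<close>. Free modules with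
  generators of squarefree degrees are squarefree, and multiplication by a monomial commutes with
  \<open>A\<close>, so the bijections \<open>x\<^sup>\<beta> : (F\<^sub>k)\<^sub>\<alpha> \<rightarrow> (F\<^sub>k)\<^sub>\<alpha>\<^sub>+\<^sub>\<beta>\<close> for \<open>k = 0, 1\<close> induce bijections on the
  cokernel, which is the required module.\<close>

section \<open>Graded modules given by projections\<close>

abbreviation poly_ring :: "('n, 'k::field) mpoly ring" where
  "poly_ring \<equiv> class_ring"

lemma (in abelian_group) additive_subgroup_criterion:
  assumes "H \<subseteq> carrier G" "\<zero> \<in> H"
    and "\<And>x y. x \<in> H \<Longrightarrow> y \<in> H \<Longrightarrow> x \<oplus> y \<in> H"
    and "\<And>x. x \<in> H \<Longrightarrow> \<ominus> x \<in> H"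
  shows "additive_subgroup H G"
  by (intro additive_subgroupI subgroup.intro) (use assms in \<open>auto simp flip: a_inv_def\<close>)

text \<open>The grading comes with explicit degree projections \<open>p\<close> instead of the
  unique existence in \<open>multigraded_module\<close>. The direct sum condition then splits into
  laws that can be checked separately: \<open>proj_sum\<close> gives existence of the decomposition;
  \<open>proj_add\<close>, \<open>proj_same\<close> and \<open>proj_other\<close> give
  uniqueness.\<close>

locale graded_module = M?: Module.module poly_ring M
  for M :: "('n, 'k::field, 'm) mgmodule" (structure) +
  fixes p :: "('n \<Rightarrow>\<^sub>0 nat) \<Rightarrow> 'm \<Rightarrow> 'm"
  assumes component_subgroup: "additive_subgroup (component M \<alpha>) M"
    and smult_component: "x \<in> component M \<beta> \<Longrightarrow>
      Poly_Mapping.single \<alpha> c \<odot> x \<in> component M (\<alpha> + \<beta>)"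
    and proj_component: "x \<in> carrier M \<Longrightarrow> p \<alpha> x \<in> component M \<alpha>"
    and proj_add: "x \<in> carrier M \<Longrightarrow> y \<in> carrier M \<Longrightarrow> p \<alpha> (x \<oplus> y) = p \<alpha> x \<oplus> p \<alpha> y"
    and proj_same: "x \<in> component M \<alpha> \<Longrightarrow> p \<alpha> x = x"
    and proj_other: "x \<in> component M \<beta> \<Longrightarrow> \<alpha> \<noteq> \<beta> \<Longrightarrow> p \<alpha> x = \<zero>"
    and proj_sum: "x \<in> carrier M \<Longrightarrow>
      \<exists>S. finite S \<and> (\<forall>\<alpha>. \<alpha> \<notin> S \<longrightarrow> p \<alpha> x = \<zero>) \<and> x = (\<Oplus>\<alpha>\<in>S. p \<alpha> x)"
begin

lemma component_closed: "x \<in> component M \<alpha> \<Longrightarrow> x \<in> carrier M"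
  using additive_subgroup.a_subset[OF component_subgroup] by blast

lemma zero_component [simp]: "\<zero> \<in> component M \<alpha>"
  using additive_subgroup.zero_closed[OF component_subgroup] .

lemma add_component:
  "x \<in> component M \<alpha> \<Longrightarrow> y \<in> component M \<alpha> \<Longrightarrow> x \<oplus> y \<in> component M \<alpha>"
  using additive_subgroup.a_closed[OF component_subgroup] .

lemma minus_component:
  "x \<in> component M \<alpha> \<Longrightarrow> y \<in> component M \<alpha> \<Longrightarrow> x \<ominus> y \<in> component M \<alpha>"
  unfolding M.minus_eq
  by (intro add_component additive_subgroup.a_inv_closed[OF component_subgroup])

lemma proj_closed: "x \<in> carrier M \<Longrightarrow> p \<alpha> x \<in> carrier M"
  using proj_component component_closed by blast

text \<open>By additivity \<open>p \<alpha>\<close> acts on each summand, and it kills those of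
  degree other than \<alpha>. A homogeneous decomposition is thus recovered from its sum.\<close>

lemma proj_finsum:
  assumes "finite S" "\<And>\<beta>. \<beta> \<in> S \<Longrightarrow> f \<beta> \<in> component M \<beta>"
  shows "p \<alpha> (\<Oplus>\<beta>\<in>S. f \<beta>) = (if \<alpha> \<in> S then f \<alpha> else \<zero>)"
  using assms
proof (induction S rule: finite_induct)
  case empty
  show ?case using proj_other[of "\<zero>" "\<alpha>"] proj_same[of "\<zero>"] by simp
next
  case (insert \<beta> S)
  have f: "f \<in> S \<rightarrow> carrier M" "f \<beta> \<in> carrier M" "\<And>\<alpha>. \<alpha> \<in> S \<Longrightarrow> f \<alpha> \<in> carrier M"
    using insert.prems component_closed by auto
  have "p \<alpha> (\<Oplus>\<beta>\<in>insert \<beta> S. f \<beta>) = p \<alpha> (f \<beta>) \<oplus> (if \<alpha> \<in> S then f \<alpha> else \<zero>)"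
    using insert f by (simp add: proj_add)
  moreover have "p \<alpha> (f \<beta>) = (if \<alpha> = \<beta> then f \<alpha> else \<zero>)"
    using insert.prems[of \<beta>] by (auto simp: proj_same proj_other)
  ultimately show ?case
    using insert f by auto
qed

lemma multigraded: "multigraded_module M"
proof -
  have "\<exists>!f. (\<forall>\<alpha>. f \<alpha> \<in> component M \<alpha>) \<and> finite {\<alpha>. f \<alpha> \<noteq> \<zero>} \<and>
      x = (\<Oplus>\<alpha> \<in> {\<alpha>. f \<alpha> \<noteq> \<zero>}. f \<alpha>)" if x: "x \<in> carrier M" for x
  proof (rule ex1I[of _ "\<lambda>\<alpha>. p \<alpha> x"])
    obtain S where S: "finite S" "\<And>\<alpha>. \<alpha> \<notin> S \<Longrightarrow> p \<alpha> x = \<zero>" "x = (\<Oplus>\<alpha>\<in>S. p \<alpha> x)"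
      using proj_sum[OF x] by blast
    \<comment> \<open>\<open>S\<close> may contain degrees with zero projection; dropping them does
      not change the sum.\<close>
    have "{\<alpha>. p \<alpha> x \<noteq> \<zero>} \<subseteq> S"
      using S(2) by blast
    moreover from this have "(\<Oplus>\<alpha> \<in> {\<alpha>. p \<alpha> x \<noteq> \<zero>}. p \<alpha> x) = (\<Oplus>\<alpha>\<in>S. p \<alpha> x)"
      by (intro M.add.finprod_mono_neutral_cong_left S(1)) (auto simp: proj_closed x)
    ultimately show "(\<forall>\<alpha>. p \<alpha> x \<in> component M \<alpha>) \<and> finite {\<alpha>. p \<alpha> x \<noteq> \<zero>} \<and>
        x = (\<Oplus>\<alpha> \<in> {\<alpha>. p \<alpha> x \<noteq> \<zero>}. p \<alpha> x)"
      using S(1,3) x proj_component finite_subset by metis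
  next
    fix f
    assume f: "(\<forall>\<alpha>. f \<alpha> \<in> component M \<alpha>) \<and> finite {\<alpha>. f \<alpha> \<noteq> \<zero>} \<and>
      x = (\<Oplus>\<alpha> \<in> {\<alpha>. f \<alpha> \<noteq> \<zero>}. f \<alpha>)"
    \<comment> \<open>Uniqueness: \<open>proj_finsum\<close> recovers \<open>f \<alpha>\<close> from
      the sum, and off the support of \<open>f\<close> both sides are zero.\<close>
    have "p \<alpha> x = f \<alpha>" for \<alpha>
      using f proj_finsum[of "{\<alpha>. f \<alpha> \<noteq> \<zero>}" f \<alpha>] by auto
    then show "f = (\<lambda>\<alpha>. p \<alpha> x)" by auto
  qed
  then show ?thesis
    unfolding multigraded_module_def
    by (intro conjI allI ballI M.module_axioms component_subgroup smult_component)
qed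

end

section \<open>Gradings and finite generation along homomorphisms\<close>

lemma (in mod_hom) hom_finsum:
  assumes "g \<in> A \<rightarrow> carrier M"
  shows "f (\<Oplus>\<^bsub>M\<^esub>a\<in>A. g a) = (\<Oplus>\<^bsub>N\<^esub>a\<in>A. f (g a))"
  using assms
proof (induction A rule: infinite_finite_induct)
  case (insert a A)
  have "(\<Oplus>\<^bsub>N\<^esub>a\<in>insert a A. f (g a)) = f (g a) \<oplus>\<^bsub>N\<^esub> (\<Oplus>\<^bsub>N\<^esub>a\<in>A. f (g a))"
    using insert by (intro finsum_insert) auto
  with insert show ?case
    by simp
\<comment> \<open>Over an infinite index set both sums are zero by convention, and \<open>f\<close>
  preserves zero.\<close>
qed auto

text \<open>Applying \<open>f\<close> to the homogeneous decomposition of \<open>x\<close> gives one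
  of \<open>f x\<close>, from which \<open>proj_finsum\<close> reads off the part of degree
  \<alpha>.\<close>

lemma degree_preserving_hom_proj:
  assumes "graded_module M p" "graded_module N q" "degree_preserving_hom M N f"
    and x: "x \<in> carrier M"
  shows "q \<alpha> (f x) = f (p \<alpha> x)"
proof -
  interpret M: graded_module M p by fact
  interpret N: graded_module N q by fact
  interpret f: mod_hom poly_ring M N f
    using assms(3) by unfold_locales (simp add: degree_preserving_hom_def)
  obtain S where S: "finite S" "\<And>\<alpha>. \<alpha> \<notin> S \<Longrightarrow> p \<alpha> x = \<zero>\<^bsub>M\<^esub>" "x = (\<Oplus>\<^bsub>M\<^esub>\<alpha>\<in>S. p \<alpha> x)"
    using M.proj_sum[OF x] by blast
  have "f x = f (\<Oplus>\<^bsub>M\<^esub>\<alpha>\<in>S. p \<alpha> x)"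
    using S(3) by simp
  also have "\<dots> = (\<Oplus>\<^bsub>N\<^esub>\<beta>\<in>S. f (p \<beta> x))"
    using S(1) x M.proj_closed by (subst f.hom_finsum) auto
  finally have "q \<alpha> (f x) = q \<alpha> (\<Oplus>\<^bsub>N\<^esub>\<beta>\<in>S. f (p \<beta> x))"
    by simp
  also have "\<dots> = (if \<alpha> \<in> S then f (p \<alpha> x) else \<zero>\<^bsub>N\<^esub>)"
    using assms(3) M.proj_component[OF x]
    by (intro N.proj_finsum S(1)) (auto simp: degree_preserving_hom_def)
  finally show ?thesis
    using S(2) by auto
qed

text \<open>A grading descends along a surjection if the kernel contains the homogeneous parts of
  its elements, which is \<open>ker\<close>. The new projections are computed on a chosen preimage,
  and \<open>ker\<close> makes the choice immaterial.\<close>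

lemma graded_module_image:
  fixes F :: "('n, 'k::field, 'a) mgmodule" and M :: "('n, 'k, 'b) mgmodule"
  assumes "graded_module F p" "Module.module poly_ring M"
    and \<pi>: "\<pi> \<in> LinearCombinations.module_hom poly_ring F M"
    and surj: "\<pi> ` carrier F = carrier M"
    and component: "\<And>\<alpha>. component M \<alpha> = \<pi> ` component F \<alpha>"
    and ker: "\<And>\<alpha> x. x \<in> carrier F \<Longrightarrow> \<pi> x = \<zero>\<^bsub>M\<^esub> \<Longrightarrow> \<pi> (p \<alpha> x) = \<zero>\<^bsub>M\<^esub>"
  shows "graded_module M (\<lambda>\<alpha> y. \<pi> (p \<alpha> (SOME x. x \<in> carrier F \<and> \<pi> x = y)))"
proof -
  interpret F: graded_module F p by fact
  interpret M: Module.module poly_ring M by fact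
  interpret \<pi>: mod_hom poly_ring F M \<pi>
    using \<pi> by unfold_locales
  define q where "q = (\<lambda>\<alpha> y. \<pi> (p \<alpha> (SOME x. x \<in> carrier F \<and> \<pi> x = y)))"
  have q: "q \<alpha> (\<pi> x) = \<pi> (p \<alpha> x)" if x: "x \<in> carrier F" for \<alpha> x
  proof -
    define x' where "x' = (SOME x'. x' \<in> carrier F \<and> \<pi> x' = \<pi> x)"
    have x': "x' \<in> carrier F \<and> \<pi> x' = \<pi> x"
      unfolding x'_def by (rule someI[of _ x]) (use x in simp)
    \<comment> \<open>Two preimages of one element differ by an element \<open>u\<close> of the
      kernel, whose part of degree \<alpha> again lies in the kernel.\<close>
    define u where "u = x' \<ominus>\<^bsub>F\<^esub> x"
    have u: "u \<in> carrier F" "x' = u \<oplus>\<^bsub>F\<^esub> x" "\<pi> u = \<zero>\<^bsub>M\<^esub>"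
      using x x' unfolding u_def
      by (simp_all add: F.M.minus_eq F.M.a_assoc F.M.l_neg M.r_neg)
    have "\<pi> (p \<alpha> x') = \<pi> (p \<alpha> u) \<oplus>\<^bsub>M\<^esub> \<pi> (p \<alpha> x)"
      using u x F.proj_closed by (simp add: F.proj_add)
    also have "\<dots> = \<pi> (p \<alpha> x)"
      using ker[OF u(1,3)] x F.proj_closed by simp
    finally show ?thesis
      unfolding q_def x'_def .
  qed
  have "graded_module M q"
  proof (intro graded_module.intro graded_module_axioms.intro)
    show "Module.module poly_ring M" by fact
  next
    fix \<alpha> :: "'n \<Rightarrow>\<^sub>0 nat"
    show "additive_subgroup (component M \<alpha>) M"
    proof (rule M.additive_subgroup_criterion)
      show "component M \<alpha> \<subseteq> carrier M"
        using F.component_closed by (auto simp: component)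
      show "\<zero>\<^bsub>M\<^esub> \<in> component M \<alpha>"
        unfolding component \<pi>.f0_is_0[symmetric] by (intro imageI F.zero_component)
      show "\<ominus>\<^bsub>M\<^esub> y \<in> component M \<alpha>" if "y \<in> component M \<alpha>" for y
      proof -
        obtain x where x: "x \<in> component F \<alpha>" "y = \<pi> x"
          using \<open>y \<in> component M \<alpha>\<close> by (auto simp: component)
        then have "\<ominus>\<^bsub>M\<^esub> y = \<pi> (\<ominus>\<^bsub>F\<^esub> x)"
          using F.component_closed by simp
        then show ?thesis
          using x additive_subgroup.a_inv_closed[OF F.component_subgroup]
          unfolding component by blast
      qed
      show "y \<oplus>\<^bsub>M\<^esub> z \<in> component M \<alpha>"
        if yz: "y \<in> component M \<alpha>" "z \<in> component M \<alpha>" for y z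
      proof -
        obtain x x' where "x \<in> component F \<alpha>" "y = \<pi> x" "x' \<in> component F \<alpha>" "z = \<pi> x'"
          using yz by (auto simp: component)
        moreover from this have "y \<oplus>\<^bsub>M\<^esub> z = \<pi> (x \<oplus>\<^bsub>F\<^esub> x')"
          using F.component_closed by simp
        ultimately show ?thesis
          using F.add_component unfolding component by blast
      qed
    qed
  next
    fix y \<alpha> \<beta> and c :: 'k
    assume "y \<in> component M \<beta>"
    then obtain x where x: "x \<in> component F \<beta>" "y = \<pi> x"
      by (auto simp: component)
    then have "Poly_Mapping.single \<alpha> c \<odot>\<^bsub>M\<^esub> y = \<pi> (Poly_Mapping.single \<alpha> c \<odot>\<^bsub>F\<^esub> x)"
      using F.component_closed by simp
    then show "Poly_Mapping.single \<alpha> c \<odot>\<^bsub>M\<^esub> y \<in> component M (\<alpha> + \<beta>)"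
      using F.smult_component[OF x(1)] unfolding component by blast
  next
    fix y \<alpha>
    assume "y \<in> carrier M"
    then obtain x where x: "x \<in> carrier F" "y = \<pi> x"
      using surj by auto
    then show "q \<alpha> y \<in> component M \<alpha>"
      using F.proj_component by (auto simp: component q)
    obtain S where S: "finite S" "\<And>\<alpha>. \<alpha> \<notin> S \<Longrightarrow> p \<alpha> x = \<zero>\<^bsub>F\<^esub>" "x = (\<Oplus>\<^bsub>F\<^esub>\<alpha>\<in>S. p \<alpha> x)"
      using F.proj_sum[OF x(1)] by blast
    have "y = \<pi> (\<Oplus>\<^bsub>F\<^esub>\<alpha>\<in>S. p \<alpha> x)"
      using S(3) x(2) by simp
    also have "\<dots> = (\<Oplus>\<^bsub>M\<^esub>\<alpha>\<in>S. q \<alpha> y)"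
      using x F.proj_closed by (subst \<pi>.hom_finsum) (auto simp: q)
    finally have y: "y = (\<Oplus>\<^bsub>M\<^esub>\<alpha>\<in>S. q \<alpha> y)" .
    have "q \<alpha> y = \<zero>\<^bsub>M\<^esub>" if "\<alpha> \<notin> S" for \<alpha>
      using S(2)[OF that] x by (simp add: q)
    with S(1) y show "\<exists>S. finite S \<and> (\<forall>\<alpha>. \<alpha> \<notin> S \<longrightarrow> q \<alpha> y = \<zero>\<^bsub>M\<^esub>) \<and> y = (\<Oplus>\<^bsub>M\<^esub>\<alpha>\<in>S. q \<alpha> y)"
      by (intro exI[of _ S]) simp
  next
    fix y z \<alpha>
    assume "y \<in> carrier M" "z \<in> carrier M"
    then have "y \<in> \<pi> ` carrier F" "z \<in> \<pi> ` carrier F"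
      unfolding surj by auto
    then obtain x x' where x: "x \<in> carrier F" "y = \<pi> x" "x' \<in> carrier F" "z = \<pi> x'"
      by auto
    then have "q \<alpha> (y \<oplus>\<^bsub>M\<^esub> z) = q \<alpha> (\<pi> (x \<oplus>\<^bsub>F\<^esub> x'))"
      by simp
    also have "\<dots> = q \<alpha> y \<oplus>\<^bsub>M\<^esub> q \<alpha> z"
      using x F.proj_closed by (simp add: q F.proj_add del: \<pi>.f_add) (simp)
    finally show "q \<alpha> (y \<oplus>\<^bsub>M\<^esub> z) = q \<alpha> y \<oplus>\<^bsub>M\<^esub> q \<alpha> z" .
  next
    fix y \<alpha>
    assume "y \<in> component M \<alpha>"
    then show "q \<alpha> y = y"
      using F.component_closed F.proj_same by (auto simp: component q)
  next
    fix y \<alpha> \<beta>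
    assume "y \<in> component M \<beta>" "\<alpha> \<noteq> \<beta>"
    then show "q \<alpha> y = \<zero>\<^bsub>M\<^esub>"
      using F.component_closed F.proj_other by (auto simp: component q)
  qed
  then show ?thesis
    unfolding q_def .
qed

text \<open>The elements \<open>\<pi> (e i)\<close> generate: lift an element of \<open>M\<close> to
  \<open>F\<close>, expand it there and apply \<open>\<pi>\<close>.\<close>

lemma finitely_generated_image:
  fixes F :: "('n, 'k::field, 'a) mgmodule" and M :: "('n, 'k, 'b) mgmodule"
  assumes "Module.module poly_ring F" "Module.module poly_ring M"
    and \<pi>: "\<pi> \<in> LinearCombinations.module_hom poly_ring F M"
    and surj: "\<pi> ` carrier F = carrier M"
    and e: "\<And>i. i < m \<Longrightarrow> e i \<in> carrier F"
    and gen: "\<And>x. x \<in> carrier F \<Longrightarrow> \<exists>v. x = (\<Oplus>\<^bsub>F\<^esub>i\<in>{..<m::nat}. v i \<odot>\<^bsub>F\<^esub> e i)"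
  shows "finitely_generated M"
proof -
  interpret F: Module.module poly_ring F by fact
  interpret M: Module.module poly_ring M by fact
  interpret \<pi>: mod_hom poly_ring F M \<pi>
    using \<pi> by unfold_locales
  define S where "S = (\<pi> \<circ> e) ` {..<m}"
  have S: "finite S" "S \<subseteq> carrier M"
    using e by (auto simp: S_def)
  have span: "LinearCombinations.submodule poly_ring (M.span S) M"
    using S by (intro M.span_is_submodule)
  have "\<pi> x \<in> M.span S" if x: "x \<in> carrier F" for x
  proof -
    obtain v where v: "x = (\<Oplus>\<^bsub>F\<^esub>i\<in>{..<m}. v i \<odot>\<^bsub>F\<^esub> e i)"
      using gen[OF x] by blast
    have sum_in_span: "finite J \<Longrightarrow> J \<subseteq> {..<m} \<Longrightarrow> (\<Oplus>\<^bsub>M\<^esub>i\<in>J. v i \<odot>\<^bsub>M\<^esub> \<pi> (e i)) \<in> M.span S" for J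
    proof (induction J rule: finite_induct)
      case empty
      then show ?case using submodule.zero_closed[OF span] by simp
    next
      case (insert j J)
      have "\<pi> (e j) \<in> M.span S"
        using M.in_own_span[OF S(2)] insert.prems by (auto simp: S_def)
      then have "v j \<odot>\<^bsub>M\<^esub> \<pi> (e j) \<in> M.span S"
        using submodule.smult_closed[OF span] by simp
      moreover have "(\<Oplus>\<^bsub>M\<^esub>i\<in>J. v i \<odot>\<^bsub>M\<^esub> \<pi> (e i)) \<in> M.span S"
        using insert by simp
      ultimately have "v j \<odot>\<^bsub>M\<^esub> \<pi> (e j) \<oplus>\<^bsub>M\<^esub> (\<Oplus>\<^bsub>M\<^esub>i\<in>J. v i \<odot>\<^bsub>M\<^esub> \<pi> (e i)) \<in> M.span S"
        by (rule submodule.m_closed[OF span])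
      also have "v j \<odot>\<^bsub>M\<^esub> \<pi> (e j) \<oplus>\<^bsub>M\<^esub> (\<Oplus>\<^bsub>M\<^esub>i\<in>J. v i \<odot>\<^bsub>M\<^esub> \<pi> (e i)) =
          (\<Oplus>\<^bsub>M\<^esub>i\<in>insert j J. v i \<odot>\<^bsub>M\<^esub> \<pi> (e i))"
        using insert e by (subst M.finsum_insert) auto
      finally show ?case .
    qed
    have "\<pi> x = (\<Oplus>\<^bsub>M\<^esub>i\<in>{..<m}. \<pi> (v i \<odot>\<^bsub>F\<^esub> e i))"
      using e unfolding v by (intro \<pi>.hom_finsum) auto
    also have "\<dots> = (\<Oplus>\<^bsub>M\<^esub>i\<in>{..<m}. v i \<odot>\<^bsub>M\<^esub> \<pi> (e i))"
      using e by (intro M.finsum_cong') auto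
    finally show ?thesis
      using sum_in_span[of "{..<m}"] by simp
  qed
  then have "carrier M \<subseteq> M.span S"
    unfolding surj[symmetric] by (rule image_subsetI)
  with submodule.subset[OF span] have "M.span S = carrier M"
    by (rule subset_antisym)
  then show ?thesis
    unfolding finitely_generated_def using S by (intro exI[of _ S] conjI)
qed

section \<open>Squarefree cokernels\<close>

text \<open>Split off from \<open>squarefree_module\<close> so that the condition on components can
  pass from the free modules to the cokernel separately from grading and finite generation.\<close>

definition squarefree_components :: "('n, 'k::field, 'm) mgmodule \<Rightarrow> bool" where
  "squarefree_components M \<longleftrightarrow>
     (\<forall>\<alpha> \<beta>. Poly_Mapping.keys \<beta> \<subseteq> Poly_Mapping.keys \<alpha> \<longrightarrow>
        bij_betw (\<lambda>y. Poly_Mapping.single \<beta> 1 \<odot>\<^bsub>M\<^esub> y) (component M \<alpha>) (component M (\<alpha> + \<beta>)))"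

text \<open>Injectivity on the cokernel is a diagram chase: if \<open>x\<^sup>\<beta> u\<close> lies in the image, then it is the
  image of a homogeneous element of degree \<open>\<alpha> + \<beta>\<close>, which is divisible by \<open>x\<^sup>\<beta>\<close> in \<open>F\<^sub>1\<close>.\<close>

lemma squarefree_components_cokernel:
  fixes F\<^sub>1 :: "('n, 'k::field, 'a) mgmodule" and F\<^sub>0 :: "('n, 'k, 'b) mgmodule"
    and M :: "('n, 'k, 'c) mgmodule"
  assumes "graded_module F\<^sub>1 p\<^sub>1" "graded_module F\<^sub>0 p\<^sub>0" "Module.module poly_ring M"
    and \<phi>: "degree_preserving_hom F\<^sub>1 F\<^sub>0 \<phi>"
    and \<pi>: "\<pi> \<in> LinearCombinations.module_hom poly_ring F\<^sub>0 M"
    and component: "\<And>\<alpha>. component M \<alpha> = \<pi> ` component F\<^sub>0 \<alpha>"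
    and exact: "\<phi> ` carrier F\<^sub>1 = {x \<in> carrier F\<^sub>0. \<pi> x = \<zero>\<^bsub>M\<^esub>}"
    and sqf1: "squarefree_components F\<^sub>1" and sqf0: "squarefree_components F\<^sub>0"
  shows "squarefree_components M"
  unfolding squarefree_components_def
proof (intro allI impI)
  fix \<alpha> \<beta> :: "'n \<Rightarrow>\<^sub>0 nat"
  assume supp: "Poly_Mapping.keys \<beta> \<subseteq> Poly_Mapping.keys \<alpha>"
  interpret F1: graded_module F\<^sub>1 p\<^sub>1 by fact
  interpret F0: graded_module F\<^sub>0 p\<^sub>0 by fact
  interpret M: Module.module poly_ring M by fact
  interpret \<phi>: mod_hom poly_ring F\<^sub>1 F\<^sub>0 \<phi>
    using \<phi> by unfold_locales (simp add: degree_preserving_hom_def)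
  interpret \<pi>: mod_hom poly_ring F\<^sub>0 M \<pi>
    using \<pi> by unfold_locales
  let ?x = "Poly_Mapping.single \<beta> 1 :: ('n, 'k) mpoly"
  have bij1: "bij_betw (\<lambda>y. ?x \<odot>\<^bsub>F\<^sub>1\<^esub> y) (component F\<^sub>1 \<alpha>) (component F\<^sub>1 (\<alpha> + \<beta>))"
    and bij0: "bij_betw (\<lambda>y. ?x \<odot>\<^bsub>F\<^sub>0\<^esub> y) (component F\<^sub>0 \<alpha>) (component F\<^sub>0 (\<alpha> + \<beta>))"
    using supp sqf1 sqf0 unfolding squarefree_components_def by blast+
  have zero: "\<pi> u = \<zero>\<^bsub>M\<^esub>"
    if u: "u \<in> component F\<^sub>0 \<alpha>" and xu: "?x \<odot>\<^bsub>M\<^esub> \<pi> u = \<zero>\<^bsub>M\<^esub>" for u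
  proof -
    have u': "u \<in> carrier F\<^sub>0"
      using u F0.component_closed by blast
    then have "?x \<odot>\<^bsub>F\<^sub>0\<^esub> u \<in> {x \<in> carrier F\<^sub>0. \<pi> x = \<zero>\<^bsub>M\<^esub>}"
      using xu by simp
    then obtain w where w: "w \<in> carrier F\<^sub>1" "\<phi> w = ?x \<odot>\<^bsub>F\<^sub>0\<^esub> u"
      unfolding exact[symmetric] by force
    \<comment> \<open>\<open>w\<close> need not be homogeneous. Since \<open>\<phi>\<close> commutes
      with the projections and its value at \<open>w\<close> is homogeneous of degree
      \<open>\<alpha> + \<beta>\<close>, the part of \<open>w\<close> of that degree has the same
      image.\<close>
    have "?x \<odot>\<^bsub>F\<^sub>0\<^esub> u = p\<^sub>0 (\<alpha> + \<beta>) (?x \<odot>\<^bsub>F\<^sub>0\<^esub> u)"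
      using F0.smult_component[OF u, of \<beta> 1] by (simp add: F0.proj_same add.commute)
    also have "\<dots> = \<phi> (p\<^sub>1 (\<alpha> + \<beta>) w)"
      using degree_preserving_hom_proj[OF assms(1,2) \<phi> w(1)] w(2) by simp
    finally have xu_eq: "?x \<odot>\<^bsub>F\<^sub>0\<^esub> u = \<phi> (p\<^sub>1 (\<alpha> + \<beta>) w)" .
    have "p\<^sub>1 (\<alpha> + \<beta>) w \<in> component F\<^sub>1 (\<alpha> + \<beta>)"
      using F1.proj_component w(1) by blast
    then obtain w' where w': "w' \<in> component F\<^sub>1 \<alpha>" "p\<^sub>1 (\<alpha> + \<beta>) w = ?x \<odot>\<^bsub>F\<^sub>1\<^esub> w'"
      using bij1 by (auto simp: bij_betw_def)
    have "w' \<in> carrier F\<^sub>1"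
      using w'(1) F1.component_closed by blast
    then have "?x \<odot>\<^bsub>F\<^sub>0\<^esub> u = ?x \<odot>\<^bsub>F\<^sub>0\<^esub> \<phi> w'"
      using xu_eq w'(2) by simp
    moreover have "\<phi> w' \<in> component F\<^sub>0 \<alpha>"
      using \<phi> w'(1) by (auto simp: degree_preserving_hom_def)
    \<comment> \<open>The monomial is cancelled in \<open>F\<^sub>0\<close>, where multiplication by
      it is injective on the component. Hence \<open>u\<close> lies in the image of
      \<open>\<phi>\<close>, the kernel of \<open>\<pi>\<close>.\<close>
    ultimately have "u = \<phi> w'"
      using bij0 u by (auto simp: bij_betw_def inj_on_def)
    then show ?thesis
      using exact \<open>w' \<in> carrier F\<^sub>1\<close> by blast
  qed
  show "bij_betw (\<lambda>y. ?x \<odot>\<^bsub>M\<^esub> y) (component M \<alpha>) (component M (\<alpha> + \<beta>))"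
    unfolding bij_betw_def
  proof
    show "inj_on (\<lambda>y. ?x \<odot>\<^bsub>M\<^esub> y) (component M \<alpha>)"
    proof
      fix y z
      assume "y \<in> component M \<alpha>" "z \<in> component M \<alpha>" and eq: "?x \<odot>\<^bsub>M\<^esub> y = ?x \<odot>\<^bsub>M\<^esub> z"
      then obtain u v where uv: "u \<in> component F\<^sub>0 \<alpha>" "y = \<pi> u" "v \<in> component F\<^sub>0 \<alpha>" "z = \<pi> v"
        by (auto simp: component)
      have uv': "u \<in> carrier F\<^sub>0" "v \<in> carrier F\<^sub>0"
        using uv F0.component_closed by blast+
      \<comment> \<open>The difference of \<open>u\<close> and \<open>v\<close> is again homogeneous
        of degree \<alpha>, so injectivity reduces to \<open>zero\<close>.\<close>
      have "?x \<odot>\<^bsub>M\<^esub> \<pi> (u \<ominus>\<^bsub>F\<^sub>0\<^esub> v) = \<pi> (?x \<odot>\<^bsub>F\<^sub>0\<^esub> (u \<ominus>\<^bsub>F\<^sub>0\<^esub> v))"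
        using uv' by (intro \<pi>.f_smult[symmetric]) auto
      also have "?x \<odot>\<^bsub>F\<^sub>0\<^esub> (u \<ominus>\<^bsub>F\<^sub>0\<^esub> v) = ?x \<odot>\<^bsub>F\<^sub>0\<^esub> u \<ominus>\<^bsub>F\<^sub>0\<^esub> ?x \<odot>\<^bsub>F\<^sub>0\<^esub> v"
        using uv' by (simp add: F0.M.minus_eq F0.M.smult_r_distr F0.M.smult_r_minus)
      also have "\<pi> \<dots> = ?x \<odot>\<^bsub>M\<^esub> y \<ominus>\<^bsub>M\<^esub> ?x \<odot>\<^bsub>M\<^esub> z"
        using uv uv' by simp
      also have "\<dots> = \<zero>\<^bsub>M\<^esub>"
        using eq uv uv' by (simp add: M.minus_eq M.r_neg)
      finally have "\<pi> (u \<ominus>\<^bsub>F\<^sub>0\<^esub> v) = \<zero>\<^bsub>M\<^esub>"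
        using uv by (intro zero F0.minus_component)
      then have "y \<ominus>\<^bsub>M\<^esub> z = \<zero>\<^bsub>M\<^esub>"
        using uv uv' by simp
      then show "y = z"
        using uv uv' by simp
    qed
  next
    \<comment> \<open>Surjectivity passes from \<open>F\<^sub>0\<close> to \<open>M\<close> because
      \<open>\<pi>\<close> commutes with the monomial and maps components onto components.\<close>
    have "(\<lambda>y. ?x \<odot>\<^bsub>M\<^esub> y) ` component M \<alpha> = \<pi> ` (\<lambda>y. ?x \<odot>\<^bsub>F\<^sub>0\<^esub> y) ` component F\<^sub>0 \<alpha>"
      unfolding component image_image
      using F0.component_closed by (intro image_cong) auto
    then show "(\<lambda>y. ?x \<odot>\<^bsub>M\<^esub> y) ` component M \<alpha> = component M (\<alpha> + \<beta>)"
      using bij0 by (simp add: bij_betw_def component)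
  qed
qed

section \<open>Quotient modules\<close>

text \<open>The scalar action is a union over all representatives, which avoids choosing one; for a
  submodule \<open>U\<close> all cosets in the union coincide.\<close>

definition quotient_module ::
  "('n, 'k::field, 'a) mgmodule \<Rightarrow> 'a set \<Rightarrow> ('n, 'k, 'a set) mgmodule" where
  "quotient_module F U =
    \<lparr>carrier = a_rcosets\<^bsub>F\<^esub> U, monoid.mult = undefined, one = undefined, zero = U, add = set_add F,
     smult = (\<lambda>r X. \<Union>x\<in>X. U +>\<^bsub>F\<^esub> (r \<odot>\<^bsub>F\<^esub> x)),
     component = (\<lambda>\<alpha>. (\<lambda>x. U +>\<^bsub>F\<^esub> x) ` component F \<alpha>)\<rparr>"

text \<open>Every element of the quotient is the coset of some \<open>x\<close>, and the operations
  on cosets can be computed on representatives, so the module laws are inherited from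
  \<open>F\<close>.\<close>

lemma
  fixes F :: "('n, 'k::field, 'a) mgmodule"
  assumes F: "Module.module poly_ring F" and U: "LinearCombinations.submodule poly_ring U F"
  shows module_quotient: "Module.module poly_ring (quotient_module F U)"
    and quotient_hom:
      "(\<lambda>x. U +>\<^bsub>F\<^esub> x) \<in> LinearCombinations.module_hom poly_ring F (quotient_module F U)"
    and quotient_surj: "(\<lambda>x. U +>\<^bsub>F\<^esub> x) ` carrier F = carrier (quotient_module F U)"
    and quotient_kernel:
      "U = {x \<in> carrier F. U +>\<^bsub>F\<^esub> x = \<zero>\<^bsub>quotient_module F U\<^esub>}"
proof -
  interpret F: Module.module poly_ring F by fact
  interpret U: LinearCombinations.submodule poly_ring U F by fact
  have "additive_subgroup U F"
  proof (rule F.additive_subgroup_criterion)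
    show "\<ominus>\<^bsub>F\<^esub> x \<in> U" if "x \<in> U" for x
    proof -
      \<comment> \<open>Closure under negation is obtained from closure under the scalar -1.\<close>
      have "(\<ominus>\<^bsub>poly_ring\<^esub> \<one>\<^bsub>poly_ring\<^esub>) \<odot>\<^bsub>F\<^esub> x = \<ominus>\<^bsub>F\<^esub> x"
        using that U.subset F.smult_one[of x] by (subst F.smult_l_minus) auto
      then show ?thesis
        using U.smult_closed[OF _ that, of "\<ominus>\<^bsub>poly_ring\<^esub> \<one>\<^bsub>poly_ring\<^esub>"] by simp
    qed
  qed (use U.subset U.zero_closed in auto)
  then interpret U: abelian_subgroup U F
    by (rule abelian_subgroupI3) unfold_locales
  let ?\<pi> = "\<lambda>x. U +>\<^bsub>F\<^esub> x" and ?M = "quotient_module F U"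
  have carrier: "carrier ?M = ?\<pi> ` carrier F"
    by (auto simp: quotient_module_def A_RCOSETS_def')
  show "?\<pi> ` carrier F = carrier ?M"
    using carrier by simp
  have zero: "\<zero>\<^bsub>?M\<^esub> = U"
    by (simp add: quotient_module_def)
  have add: "?\<pi> x \<oplus>\<^bsub>?M\<^esub> ?\<pi> y = ?\<pi> (x \<oplus>\<^bsub>F\<^esub> y)" if "x \<in> carrier F" "y \<in> carrier F" for x y
    using U.a_rcos_sum[OF that] by (simp add: quotient_module_def)
  have eq: "?\<pi> y = ?\<pi> x" if "x \<in> carrier F" "y \<in> ?\<pi> x" for x y
    using U.a_repr_independence'[OF that(2,1)] by simp
  have smult: "r \<odot>\<^bsub>?M\<^esub> ?\<pi> x = ?\<pi> (r \<odot>\<^bsub>F\<^esub> x)" if x: "x \<in> carrier F" for r x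
  proof -
    \<comment> \<open>Two representatives differ by some \<open>u\<close> in \<open>U\<close>, and
      \<open>U\<close> also contains \<open>r\<close> times \<open>u\<close>.\<close>
    have const: "?\<pi> (r \<odot>\<^bsub>F\<^esub> y) = ?\<pi> (r \<odot>\<^bsub>F\<^esub> x)" if y: "y \<in> ?\<pi> x" for y
    proof -
      obtain u where u: "u \<in> U" "y = u \<oplus>\<^bsub>F\<^esub> x"
        using y by (auto simp: a_r_coset_def')
      have "r \<odot>\<^bsub>F\<^esub> y = r \<odot>\<^bsub>F\<^esub> u \<oplus>\<^bsub>F\<^esub> r \<odot>\<^bsub>F\<^esub> x"
        using u x U.subset by (auto intro!: F.smult_r_distr)
      moreover have "r \<odot>\<^bsub>F\<^esub> u \<in> U"
        using u by simp
      ultimately have "r \<odot>\<^bsub>F\<^esub> y \<in> ?\<pi> (r \<odot>\<^bsub>F\<^esub> x)"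
        by (auto simp: a_r_coset_def')
      then show ?thesis
        using x by (intro eq) auto
    qed
    \<comment> \<open>The union runs over a nonempty set, as \<open>x\<close> lies in its own coset,
      so it equals its constant value.\<close>
    have "(\<Union>y\<in>?\<pi> x. ?\<pi> (r \<odot>\<^bsub>F\<^esub> y)) = ?\<pi> (r \<odot>\<^bsub>F\<^esub> x)"
      using U.a_rcos_self[OF x] by (rule UN_constant_eq) (intro ballI const)
    then show ?thesis
      by (simp add: quotient_module_def)
  qed
  have \<pi>_zero: "?\<pi> \<zero>\<^bsub>F\<^esub> = \<zero>\<^bsub>?M\<^esub>"
    using U.subset by (simp add: zero F.a_coset_add_zero)
  show "?\<pi> \<in> LinearCombinations.module_hom poly_ring F ?M"
    unfolding LinearCombinations.module_hom_def by (auto simp: carrier add smult)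
  show "U = {x \<in> carrier F. ?\<pi> x = \<zero>\<^bsub>?M\<^esub>}"
  proof (rule Set.set_eqI)
    show "x \<in> U \<longleftrightarrow> x \<in> {x \<in> carrier F. ?\<pi> x = \<zero>\<^bsub>?M\<^esub>}" for x
      using subsetD[OF U.subset, of x] U.a_rcos_self[of x] U.a_rcos_const[of x] by (auto simp: zero)
  qed
  have "(a + b) \<odot>\<^bsub>F\<^esub> x = a \<odot>\<^bsub>F\<^esub> x \<oplus>\<^bsub>F\<^esub> b \<odot>\<^bsub>F\<^esub> x"
    and "(a * b) \<odot>\<^bsub>F\<^esub> x = a \<odot>\<^bsub>F\<^esub> (b \<odot>\<^bsub>F\<^esub> x)" and "1 \<odot>\<^bsub>F\<^esub> x = x"
    if "x \<in> carrier F" for a b x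
    using F.smult_l_distr[of a b x] F.smult_assoc1[of a b x] F.smult_one[of x] that by simp_all
  note smult_simps = this
  show "Module.module poly_ring ?M"
  proof (rule moduleI)
    show "abelian_group ?M"
    proof (rule abelian_groupI)
      show "\<exists>y\<in>carrier ?M. y \<oplus>\<^bsub>?M\<^esub> x = \<zero>\<^bsub>?M\<^esub>" if "x \<in> carrier ?M" for x
        using that unfolding carrier
        by (auto intro!: bexI[of _ "\<ominus>\<^bsub>F\<^esub> _"] simp: add F.l_neg \<pi>_zero)
    qed (auto simp: carrier add F.a_ac simp flip: \<pi>_zero)
  qed (auto simp: carrier add smult smult_simps F.smult_r_distr class_cring.is_cring)
qed

section \<open>Free modules\<close>

text \<open>Addition of exponents is cancellative, so \<delta> is the only exponent of
  \<open>p\<close> that contributes to this coefficient.\<close>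

lemma lookup_single_times:
  fixes p :: "('a \<Rightarrow>\<^sub>0 nat) \<Rightarrow>\<^sub>0 'k::comm_semiring_1"
  shows "Poly_Mapping.lookup (Poly_Mapping.single \<beta> c * p) (\<beta> + \<delta>) = c * Poly_Mapping.lookup p \<delta>"
proof -
  have "(\<Sum>q. Poly_Mapping.lookup p q when \<beta> + \<delta> = \<beta> + q) = Poly_Mapping.lookup p \<delta>"
    by simp
  then show ?thesis
    by (simp add: lookup_mult lookup_single when_mult)
qed

lemma keys_single_times:
  fixes p :: "('a \<Rightarrow>\<^sub>0 nat) \<Rightarrow>\<^sub>0 'k::comm_semiring_1"
  assumes "\<epsilon> \<in> Poly_Mapping.keys (Poly_Mapping.single \<beta> c * p)"
  obtains \<delta> where "\<delta> \<in> Poly_Mapping.keys p" "\<epsilon> = \<beta> + \<delta>"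
  using subsetD[OF keys_mult assms] by (auto split: if_splits)

text \<open>The free module on generators of degrees \<open>b i\<close>. A coordinate of a vector of degree \<open>\<alpha>\<close> has
  degree \<open>\<alpha> - b i\<close>, which is stated without the truncated subtraction.\<close>

definition free_mgmodule ::
  "nat \<Rightarrow> (nat \<Rightarrow> 'n \<Rightarrow>\<^sub>0 nat) \<Rightarrow> ('n, 'k::field, ('n, 'k) mpoly vec) mgmodule" where
  "free_mgmodule m b =
    \<lparr>carrier = carrier_vec m, monoid.mult = undefined, one = undefined, zero = 0\<^sub>v m, add = (+),
     smult = (\<cdot>\<^sub>v),
     component = (\<lambda>\<alpha>. {v \<in> carrier_vec m. \<forall>i<m. \<forall>\<delta>\<in>Poly_Mapping.keys (v $ i). b i + \<delta> = \<alpha>})\<rparr>"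

lemma free_simps [simp]:
  "carrier (free_mgmodule m b) = carrier_vec m"
  "add (free_mgmodule m b) = (+)"
  "zero (free_mgmodule m b) = 0\<^sub>v m"
  "smult (free_mgmodule m b) = (\<cdot>\<^sub>v)"
  by (simp_all add: free_mgmodule_def)

lemma component_free:
  "v \<in> component (free_mgmodule m b) \<alpha> \<longleftrightarrow>
    v \<in> carrier_vec m \<and> (\<forall>i<m. \<forall>\<delta>\<in>Poly_Mapping.keys (v $ i). b i + \<delta> = \<alpha>)"
  by (simp add: free_mgmodule_def)

lemma component_free_lookup:
  "v \<in> component (free_mgmodule m b) \<alpha> \<Longrightarrow> i < m \<Longrightarrow> b i + \<delta> \<noteq> \<alpha> \<Longrightarrow>
    Poly_Mapping.lookup (v $ i) \<delta> = 0"
  unfolding component_free Ball_def in_keys_iff by auto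

lemma component_free_carrier: "v \<in> component (free_mgmodule m b) \<alpha> \<Longrightarrow> v \<in> carrier_vec m"
  by (simp add: component_free)

lemma module_free:
  fixes b :: "nat \<Rightarrow> 'n \<Rightarrow>\<^sub>0 nat"
  shows "Module.module (poly_ring :: ('n, 'k::field) mpoly ring) (free_mgmodule m b)"
proof (rule moduleI)
  let ?F = "free_mgmodule m b :: ('n, 'k, ('n, 'k) mpoly vec) mgmodule"
  show "abelian_group ?F"
  proof (rule abelian_groupI)
    show "\<exists>w\<in>carrier ?F. w \<oplus>\<^bsub>?F\<^esub> v = \<zero>\<^bsub>?F\<^esub>"
      if "v \<in> carrier ?F" for v
      using that by (intro bexI[of _ "- v"]) auto
  qed (auto intro: comm_add_vec)
qed (auto simp: add_smult_distrib_vec smult_add_distrib_vec smult_smult_assoc intro: class_cring.is_cring)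

lemma finsum_free_index:
  assumes "i < m" "f \<in> S \<rightarrow> carrier_vec m"
  shows "(\<Oplus>\<^bsub>free_mgmodule m b\<^esub>a\<in>S. f a) $ i = (\<Sum>a\<in>S. f a $ i)"
proof -
  interpret Module.module poly_ring "free_mgmodule m b"
    by (rule module_free)
  show ?thesis
    using assms(2)
  proof (induction S rule: infinite_finite_induct)
    case (insert a S)
    have "(\<Oplus>\<^bsub>free_mgmodule m b\<^esub>a\<in>insert a S. f a) = f a + (\<Oplus>\<^bsub>free_mgmodule m b\<^esub>a\<in>S. f a)"
      using insert by (subst finsum_insert) auto
    moreover have "(\<Oplus>\<^bsub>free_mgmodule m b\<^esub>a\<in>S. f a) \<in> carrier_vec m"
      using insert finsum_closed[of f S] by simp
    ultimately show ?case
      using insert assms(1) by auto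
  qed (use assms(1) in auto)
qed

text \<open>This serves three purposes: the unit vectors form a basis, they generate the cokernel,
  and the columns of \<open>A\<close> are the images of basis elements.\<close>

lemma finsum_free_unit_vec:
  "(\<Oplus>\<^bsub>free_mgmodule m b\<^esub>i\<in>{..<m}. f i \<odot>\<^bsub>free_mgmodule m b\<^esub> unit_vec m i) = vec m f"
proof (rule eq_vecI)
  interpret Module.module poly_ring "free_mgmodule m b"
    by (rule module_free)
  show "dim_vec (\<Oplus>\<^bsub>free_mgmodule m b\<^esub>i\<in>{..<m}. f i \<odot>\<^bsub>free_mgmodule m b\<^esub> unit_vec m i) = dim_vec (vec m f)"
    using finsum_closed[of "\<lambda>i. f i \<odot>\<^bsub>free_mgmodule m b\<^esub> unit_vec m i" "{..<m}"] by auto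
  fix i
  assume "i < dim_vec (vec m f)"
  then have i: "i < m" by simp
  have "(\<Oplus>\<^bsub>free_mgmodule m b\<^esub>i\<in>{..<m}. f i \<odot>\<^bsub>free_mgmodule m b\<^esub> unit_vec m i) $ i =
      (\<Sum>j<m. f j * (if i = j then 1 else 0))"
    using i by (subst finsum_free_index) auto
  also have "\<dots> = (\<Sum>j<m. if i = j then f j else 0)"
    by (intro sum.cong) auto
  finally show "(\<Oplus>\<^bsub>free_mgmodule m b\<^esub>i\<in>{..<m}. f i \<odot>\<^bsub>free_mgmodule m b\<^esub> unit_vec m i) $ i = vec m f $ i"
    using i by simp
qed

lemma multigraded_basis_free:
  fixes b :: "nat \<Rightarrow> 'n \<Rightarrow>\<^sub>0 nat"
  shows "multigraded_basis (free_mgmodule m b :: ('n, 'k::field, ('n, 'k) mpoly vec) mgmodule)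
    m (unit_vec m)"
  unfolding multigraded_basis_def finsum_free_unit_vec
proof (intro conjI allI impI ballI)
  fix i
  assume i: "i < m"
  show "\<exists>\<alpha>. unit_vec m i \<in> component (free_mgmodule m b) \<alpha>"
    \<comment> \<open>The only exponent in this unit vector is 0, in entry \<open>i\<close>, so its
      degree is \<open>b i\<close>.\<close>
    using i by (intro exI[of _ "b i"]) (auto simp: component_free)
next
  fix x :: "('n, 'k) mpoly vec"
  assume x: "x \<in> carrier (free_mgmodule m b)"
  have "vec m (\<lambda>i. v $ i) = v" if "v \<in> carrier_vec m" for v :: "('n, 'k) mpoly vec"
    using that by auto
  then show "\<exists>!v. v \<in> carrier_vec m \<and> x = vec m (\<lambda>i. v $ i)"
    using x by (intro ex1I[of _ x]) auto
qed

section \<open>The grading of a free module\<close>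

definition free_proj ::
  "nat \<Rightarrow> (nat \<Rightarrow> 'n \<Rightarrow>\<^sub>0 nat) \<Rightarrow> ('n \<Rightarrow>\<^sub>0 nat) \<Rightarrow> ('n, 'k::field) mpoly vec \<Rightarrow> ('n, 'k) mpoly vec" where
  "free_proj m b \<alpha> v = vec m (\<lambda>i. Poly_Mapping.mapp (\<lambda>\<delta> c. c when b i + \<delta> = \<alpha>) (v $ i))"

lemma lookup_free_proj:
  "i < m \<Longrightarrow> Poly_Mapping.lookup (free_proj m b \<alpha> v $ i) \<delta> =
    (Poly_Mapping.lookup (v $ i) \<delta> when b i + \<delta> = \<alpha>)"
  by (auto simp: free_proj_def lookup_mapp when_def in_keys_iff)

lemma dim_free_proj [simp]: "dim_vec (free_proj m b \<alpha> v) = m"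
  by (simp add: free_proj_def)

lemma free_proj_carrier [simp]: "free_proj m b \<alpha> v \<in> carrier_vec m"
  by (rule carrier_vecI) (rule dim_free_proj)

lemma mpoly_vec_eqI:
  assumes "v \<in> carrier_vec m" "w \<in> carrier_vec m"
    and "\<And>i \<delta>. i < m \<Longrightarrow> Poly_Mapping.lookup (v $ i) \<delta> = Poly_Mapping.lookup (w $ i) \<delta>"
  shows "v = w"
  using assms by (intro eq_vecI poly_mapping_eqI) auto

text \<open>A term x^\<delta> in coordinate \<open>i\<close> has the single degree
  \<open>b i + \<delta>\<close>, so sorting terms by degree splits a vector into finitely many
  homogeneous parts.\<close>

lemma graded_module_free:
  fixes b :: "nat \<Rightarrow> 'n \<Rightarrow>\<^sub>0 nat"
  shows "graded_module (free_mgmodule m b :: ('n, 'k::field, ('n, 'k) mpoly vec) mgmodule)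
    (free_proj m b)"
proof (intro graded_module.intro graded_module_axioms.intro)
  let ?F = "free_mgmodule m b :: ('n, 'k, ('n, 'k) mpoly vec) mgmodule"
  show "Module.module poly_ring ?F"
    by (rule module_free)
  then interpret Module.module poly_ring ?F .
  fix \<alpha> \<beta> :: "'n \<Rightarrow>\<^sub>0 nat" and v w :: "('n, 'k) mpoly vec"
  show "additive_subgroup (component ?F \<alpha>) ?F"
  proof (rule additive_subgroup_criterion)
    show "\<ominus>\<^bsub>?F\<^esub> v \<in> component ?F \<alpha>"
      if "v \<in> component ?F \<alpha>" for v
    proof -
      have v: "v \<in> carrier_vec m"
        using that by (simp add: component_free)
      then have "\<ominus>\<^bsub>?F\<^esub> v = - v"
        by (intro minus_equality) auto
      then show ?thesis
        using that v by (auto simp: component_free in_keys_iff)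
    qed
    show "v \<oplus>\<^bsub>?F\<^esub> w \<in> component ?F \<alpha>"
      if "v \<in> component ?F \<alpha>" "w \<in> component ?F \<alpha>"
      for v w
      using that by (auto simp: component_free dest!: subsetD[OF keys_add])
  qed (auto simp: component_free)
  show "Poly_Mapping.single \<alpha> c \<odot>\<^bsub>?F\<^esub> v \<in> component ?F (\<alpha> + \<beta>)"
    if "v \<in> component ?F \<beta>" for c
    using that by (auto simp: component_free add.left_commute elim!: keys_single_times)
  show "free_proj m b \<alpha> v \<in> component ?F \<alpha>"
    by (auto simp: component_free in_keys_iff lookup_free_proj)
  show "free_proj m b \<alpha> (v \<oplus>\<^bsub>?F\<^esub> w) =
      free_proj m b \<alpha> v \<oplus>\<^bsub>?F\<^esub> free_proj m b \<alpha> w"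
    if "v \<in> carrier ?F" "w \<in> carrier ?F"
    using that by (intro mpoly_vec_eqI[of _ m]) (auto simp: lookup_free_proj lookup_add when_add_distrib)
  show "free_proj m b \<alpha> v = v" if "v \<in> component ?F \<alpha>"
    using that by (intro mpoly_vec_eqI[of _ m])
      (auto simp: lookup_free_proj component_free_lookup component_free_carrier when_def)
  show "free_proj m b \<alpha> v = \<zero>\<^bsub>?F\<^esub>"
    if "v \<in> component ?F \<beta>" "\<alpha> \<noteq> \<beta>"
    using that by (intro mpoly_vec_eqI[of _ m])
      (auto simp: lookup_free_proj component_free_lookup component_free_carrier when_def)
  show "\<exists>S. finite S \<and> (\<forall>\<alpha>. \<alpha> \<notin> S \<longrightarrow> free_proj m b \<alpha> v = \<zero>\<^bsub>?F\<^esub>) \<and>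
      v = (\<Oplus>\<^bsub>?F\<^esub>\<alpha>\<in>S. free_proj m b \<alpha> v)"
    if v: "v \<in> carrier ?F"
  proof (intro exI conjI allI impI)
    let ?S = "\<Union>i<m. (\<lambda>\<delta>. b i + \<delta>) ` Poly_Mapping.keys (v $ i)"
    show fin: "finite ?S"
      by simp
    have S: "Poly_Mapping.lookup (v $ i) \<delta> = 0" if "i < m" "b i + \<delta> \<notin> ?S" for i \<delta>
    proof (rule ccontr)
      assume "Poly_Mapping.lookup (v $ i) \<delta> \<noteq> 0"
      then have "\<delta> \<in> Poly_Mapping.keys (v $ i)"
        by (simp add: in_keys_iff)
      then show False
        using that by auto
    qed
    show "free_proj m b \<alpha> v = \<zero>\<^bsub>?F\<^esub>" if "\<alpha> \<notin> ?S" for \<alpha>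
    proof (rule mpoly_vec_eqI[of _ m])
      show "Poly_Mapping.lookup (free_proj m b \<alpha> v $ i) \<delta> = Poly_Mapping.lookup (\<zero>\<^bsub>?F\<^esub> $ i) \<delta>"
        if "i < m" for i \<delta>
        using S[of i \<delta>] \<open>i < m\<close> \<open>\<alpha> \<notin> ?S\<close> by (simp add: lookup_free_proj when_def del: UN_iff)
    qed auto
    show "v = (\<Oplus>\<^bsub>?F\<^esub>\<alpha>\<in>?S. free_proj m b \<alpha> v)"
    proof (rule mpoly_vec_eqI)
      show "v \<in> carrier_vec m" using v by simp
      show "(\<Oplus>\<^bsub>?F\<^esub>\<alpha>\<in>?S. free_proj m b \<alpha> v) \<in> carrier_vec m"
        using finsum_closed[of "\<lambda>\<alpha>. free_proj m b \<alpha> v" ?S] by simp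
      fix i \<delta>
      assume i: "i < m"
      \<comment> \<open>Only the summand with \<alpha> equal to \<open>b i + \<delta>\<close> can
        carry this coefficient; if that degree is outside \<open>?S\<close>, the coefficient is
        zero.\<close>
      have "Poly_Mapping.lookup (v $ i) \<delta> =
          (\<Sum>\<alpha>\<in>?S. Poly_Mapping.lookup (v $ i) \<delta> when b i + \<delta> = \<alpha>)"
        using S[OF i, of \<delta>] unfolding when_def sum.delta'[OF fin] by (simp split: if_split)
      also have "\<dots> = Poly_Mapping.lookup ((\<Oplus>\<^bsub>?F\<^esub>\<alpha>\<in>?S. free_proj m b \<alpha> v) $ i) \<delta>"
        using i by (simp add: finsum_free_index lookup_sum lookup_free_proj)
      finally show "Poly_Mapping.lookup (v $ i) \<delta> =
          Poly_Mapping.lookup ((\<Oplus>\<^bsub>?F\<^esub>\<alpha>\<in>?S. free_proj m b \<alpha> v) $ i) \<delta>" .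
    qed
  qed
qed

text \<open>If \<open>b i + \<delta> = \<alpha> + \<beta>\<close> with \<open>b i\<close> squarefree and \<open>supp(\<beta>) \<subseteq> supp(\<alpha>)\<close>, then \<open>\<delta> \<ge> \<beta>\<close>, so
  \<open>x\<^sup>\<delta>\<close> is divisible by \<open>x\<^sup>\<beta>\<close>.\<close>

lemma squarefree_components_free:
  fixes b :: "nat \<Rightarrow> 'n \<Rightarrow>\<^sub>0 nat"
  assumes b: "\<And>i t. i < m \<Longrightarrow> Poly_Mapping.lookup (b i) t \<le> 1"
  shows "squarefree_components (free_mgmodule m b :: ('n, 'k::field, ('n, 'k) mpoly vec) mgmodule)"
  unfolding squarefree_components_def bij_betw_def
proof (intro allI impI conjI)
  fix \<alpha> \<beta> :: "'n \<Rightarrow>\<^sub>0 nat"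
  assume supp: "Poly_Mapping.keys \<beta> \<subseteq> Poly_Mapping.keys \<alpha>"
  let ?F = "free_mgmodule m b :: ('n, 'k, ('n, 'k) mpoly vec) mgmodule"
  let ?x = "Poly_Mapping.single \<beta> 1 :: ('n, 'k) mpoly"
  show "inj_on (\<lambda>y. ?x \<odot>\<^bsub>?F\<^esub> y) (component ?F \<alpha>)"
  proof
    fix v w
    assume "v \<in> component ?F \<alpha>" "w \<in> component ?F \<alpha>" and eq: "?x \<odot>\<^bsub>?F\<^esub> v = ?x \<odot>\<^bsub>?F\<^esub> w"
    then have vw: "v \<in> carrier_vec m" "w \<in> carrier_vec m"
      by (simp_all add: component_free)
    show "v = w"
    proof (rule mpoly_vec_eqI[OF vw])
      fix i \<delta>
      assume "i < m"
      then have "?x * v $ i = ?x * w $ i"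
        using arg_cong[OF eq, of "\<lambda>u. u $ i"] vw by simp
      \<comment> \<open>The products are compared at the exponent
        \<open>\<beta> + \<delta>\<close>.\<close>
      then show "Poly_Mapping.lookup (v $ i) \<delta> = Poly_Mapping.lookup (w $ i) \<delta>"
        using lookup_single_times[of \<beta> 1 _ \<delta>] by (metis mult_1)
    qed
  qed
  show "(\<lambda>y. ?x \<odot>\<^bsub>?F\<^esub> y) ` component ?F \<alpha> = component ?F (\<alpha> + \<beta>)"
  proof (intro subset_antisym subsetI)
    fix v
    assume "v \<in> (\<lambda>y. ?x \<odot>\<^bsub>?F\<^esub> y) ` component ?F \<alpha>"
    then show "v \<in> component ?F (\<alpha> + \<beta>)"
      using graded_module.smult_component[OF graded_module_free, of _ m b \<alpha> \<beta> 1]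
      by (auto simp: add.commute)
  next
    fix v
    assume v: "v \<in> component ?F (\<alpha> + \<beta>)"
    \<comment> \<open>\<open>w\<close> is the quotient of \<open>v\<close> by x^\<beta>: the
      coefficient at \<open>\<beta> + \<delta>\<close> moves to \<delta>. Terms not divisible by
      x^\<beta> would be lost; \<open>div\<close> shows that there are none.\<close>
    define w where "w = vec m (\<lambda>i. Poly_Mapping.map_key (\<lambda>\<delta>. \<beta> + \<delta>) (v $ i))"
    have dim_w: "dim_vec w = m"
      by (simp add: w_def)
    have inj: "inj (\<lambda>\<delta>. \<beta> + \<delta>)"
      by simp
    have lookup_w: "Poly_Mapping.lookup (w $ i) \<delta> = Poly_Mapping.lookup (v $ i) (\<beta> + \<delta>)"
      if "i < m" for i \<delta>
      using that by (simp add: w_def map_key.rep_eq[OF inj])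
    have div: "\<exists>\<delta>'. \<delta> = \<beta> + \<delta>'" if "i < m" "\<delta> \<in> Poly_Mapping.keys (v $ i)" for i \<delta>
    proof -
      have eq: "b i + \<delta> = \<alpha> + \<beta>"
        using v that by (simp add: component_free)
      \<comment> \<open>On the support of \<beta> the entry of \<alpha> is at least 1 and that of
        \<open>b i\<close> at most 1, so the entry of \<delta> is at least that of \<beta>.
        Elsewhere \<beta> vanishes.\<close>
      have "Poly_Mapping.lookup \<beta> t \<le> Poly_Mapping.lookup \<delta> t" for t
      proof (cases "t \<in> Poly_Mapping.keys \<beta>")
        case True
        then have "Poly_Mapping.lookup \<alpha> t \<noteq> 0"
          using subsetD[OF supp True] by (simp add: in_keys_iff)
        moreover have "Poly_Mapping.lookup (b i) t + Poly_Mapping.lookup \<delta> t =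
            Poly_Mapping.lookup \<alpha> t + Poly_Mapping.lookup \<beta> t"
          using arg_cong[OF eq, of "\<lambda>\<gamma>. Poly_Mapping.lookup \<gamma> t"] by (simp add: lookup_add)
        ultimately show ?thesis
          using b[OF that(1), of t] by linarith
      qed (simp add: in_keys_iff)
      then have "\<delta> = \<beta> + (\<delta> - \<beta>)"
        by (intro poly_mapping_eqI) (simp add: lookup_add lookup_minus)
      then show ?thesis ..
    qed
    have "w \<in> component ?F \<alpha>"
      unfolding component_free
    proof (intro conjI allI impI ballI)
      show "w \<in> carrier_vec m"
        by (simp add: w_def)
      fix i \<delta>
      assume i: "i < m" and "\<delta> \<in> Poly_Mapping.keys (w $ i)"
      then have "\<beta> + \<delta> \<in> Poly_Mapping.keys (v $ i)"
        by (simp add: in_keys_iff lookup_w)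
      then have "b i + (\<beta> + \<delta>) = \<alpha> + \<beta>"
        using v i by (auto simp: component_free)
      then have "\<beta> + (b i + \<delta>) = \<beta> + \<alpha>"
        by (simp add: ac_simps)
      then show "b i + \<delta> = \<alpha>"
        by simp
    qed
    moreover have "v = ?x \<odot>\<^bsub>?F\<^esub> w"
    proof (rule mpoly_vec_eqI[of _ m])
      fix i \<delta>
      assume i: "i < m"
      show "Poly_Mapping.lookup (v $ i) \<delta> = Poly_Mapping.lookup ((?x \<odot>\<^bsub>?F\<^esub> w) $ i) \<delta>"
      \<comment> \<open>Off the multiples of x^\<beta> both coefficients vanish: for
        \<open>v\<close> by \<open>div\<close>, for the product by
        \<open>keys_single_times\<close>.\<close>
      proof (cases "\<exists>\<delta>'. \<delta> = \<beta> + \<delta>'")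
        case True
        then show ?thesis
          using i by (auto simp: dim_w lookup_single_times lookup_w)
      next
        case False
        then have "\<delta> \<notin> Poly_Mapping.keys (v $ i)" "\<delta> \<notin> Poly_Mapping.keys (?x * w $ i)"
          using div[OF i] keys_single_times[of \<delta> \<beta> 1 "w $ i"] by blast+
        then show ?thesis
          using i by (simp add: dim_w in_keys_iff)
      qed
    qed (use v in \<open>simp_all add: w_def component_free\<close>)
    ultimately show "v \<in> (\<lambda>y. ?x \<odot>\<^bsub>?F\<^esub> y) ` component ?F \<alpha>"
      by (rule rev_image_eqI)
  qed
qed

section \<open>Matrices as degree-preserving maps\<close>

text \<open>A term x^\<mu> of \<open>A $$ (i, j)\<close> times a term x^\<nu> of
  \<open>v $ j\<close> has degree \<open>b i + \<mu> + \<nu> = g j + \<nu> = \<alpha>\<close>.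
  Hypothesis \<open>deg\<close> ranges over exponents that occur, so zero entries impose no
  equation, as in the system for \<open>A\<close>.\<close>

lemma degree_preserving_mult_mat_vec:
  fixes A :: "('n, 'k::field) mpoly mat"
  assumes A: "A \<in> carrier_mat s l"
    and deg: "\<And>i j \<alpha>. i < s \<Longrightarrow> j < l \<Longrightarrow> \<alpha> \<in> Poly_Mapping.keys (A $$ (i, j)) \<Longrightarrow> g j = b i + \<alpha>"
  shows "degree_preserving_hom (free_mgmodule l g) (free_mgmodule s b) (\<lambda>v. A *\<^sub>v v)"
proof -
  have "A *\<^sub>v v \<in> component (free_mgmodule s b) \<alpha>" if v: "v \<in> component (free_mgmodule l g) \<alpha>" for \<alpha> v
    unfolding component_free
  proof (intro conjI allI impI ballI)
    have v': "v \<in> carrier_vec l"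
      using v by (simp add: component_free)
    then show "A *\<^sub>v v \<in> carrier_vec s"
      using A by simp
    fix i \<delta>
    assume i: "i < s" and "\<delta> \<in> Poly_Mapping.keys ((A *\<^sub>v v) $ i)"
    moreover have "(A *\<^sub>v v) $ i = (\<Sum>j<l. A $$ (i, j) * v $ j)"
      using A i v' by (auto simp: scalar_prod_def atLeast0LessThan intro!: sum.cong)
    ultimately have "(\<Sum>j<l. Poly_Mapping.lookup (A $$ (i, j) * v $ j) \<delta>) \<noteq> 0"
      by (simp add: in_keys_iff lookup_sum)
    then obtain j where j: "j < l" "Poly_Mapping.lookup (A $$ (i, j) * v $ j) \<delta> \<noteq> 0"
      by (metis (no_types, lifting) lessThan_iff sum.neutral)
    then obtain \<mu> \<nu> where "\<mu> \<in> Poly_Mapping.keys (A $$ (i, j))" "\<nu> \<in> Poly_Mapping.keys (v $ j)" "\<delta> = \<mu> + \<nu>"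
      using keys_mult[of "A $$ (i, j)" "v $ j"] by (auto simp flip: in_keys_iff)
    moreover from this have "g j + \<nu> = \<alpha>"
      using v j(1) by (auto simp: component_free)
    moreover from calculation have "g j = b i + \<mu>"
      using deg[OF i j(1)] by simp
    ultimately show "b i + \<delta> = \<alpha>"
      by (simp add: add.assoc)
  qed
  moreover have "A *\<^sub>v (r \<cdot>\<^sub>v v) = r \<cdot>\<^sub>v (A *\<^sub>v v)" if "v \<in> carrier_vec l" for r v
    using A that by (intro eq_vecI) auto
  ultimately show ?thesis
    using A unfolding degree_preserving_hom_def LinearCombinations.module_hom_def
    by (auto simp: mult_add_distrib_mat_vec)
qed

section \<open>The cokernel of a squarefree matrix\<close>

text \<open>Here \<open>g\<close> and \<open>b\<close> are the solution of the system, written as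
  exponent vectors. The module is the free module with degrees \<open>b\<close> modulo the image of
  \<open>A\<close>.\<close>

lemma cokernel_squarefree:
  fixes A :: "('n, 'k::field) mpoly mat"
  assumes A: "A \<in> carrier_mat s l"
    and deg: "\<And>i j \<alpha>. i < s \<Longrightarrow> j < l \<Longrightarrow> \<alpha> \<in> Poly_Mapping.keys (A $$ (i, j)) \<Longrightarrow> g j = b i + \<alpha>"
    and g: "\<And>j t. j < l \<Longrightarrow> Poly_Mapping.lookup (g j) t \<le> 1"
    and b: "\<And>i t. i < s \<Longrightarrow> Poly_Mapping.lookup (b i) t \<le> 1"
  shows "\<exists>M :: ('n, 'k, ('n, 'k) mpoly vec set) mgmodule.
    squarefree_module M \<and> has_presentation_matrix M A"
proof -
  let ?F1 = "free_mgmodule l g :: ('n, 'k, ('n, 'k) mpoly vec) mgmodule"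
  let ?F0 = "free_mgmodule s b :: ('n, 'k, ('n, 'k) mpoly vec) mgmodule"
  define \<phi> where "\<phi> = (\<lambda>v. A *\<^sub>v v)"
  define U where "U = \<phi> ` carrier ?F1"
  define M where "M = quotient_module ?F0 U"
  define \<pi> where "\<pi> = (\<lambda>x. U +>\<^bsub>?F0\<^esub> x)"
  have \<phi>: "degree_preserving_hom ?F1 ?F0 \<phi>"
    unfolding \<phi>_def using A deg by (rule degree_preserving_mult_mat_vec)
  interpret \<phi>: mod_hom poly_ring ?F1 ?F0 \<phi>
    using \<phi> by (intro mod_hom.intro mod_hom_axioms.intro module_free) (simp add: degree_preserving_hom_def)
  have U: "LinearCombinations.submodule poly_ring U ?F0"
    using \<phi>.im_is_submodule unfolding U_def \<phi>.im_def .
  have M: "Module.module poly_ring M"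
    and \<pi>: "\<pi> \<in> LinearCombinations.module_hom poly_ring ?F0 M"
    and surj: "\<pi> ` carrier ?F0 = carrier M"
    and exact: "\<phi> ` carrier ?F1 = {x \<in> carrier ?F0. \<pi> x = \<zero>\<^bsub>M\<^esub>}"
    using module_quotient[OF module_free U] quotient_hom[OF module_free U]
      quotient_surj[OF module_free U] quotient_kernel[OF module_free U]
    unfolding M_def \<pi>_def U_def[symmetric] .
  have component: "component M \<alpha> = \<pi> ` component ?F0 \<alpha>" for \<alpha>
    by (simp add: M_def \<pi>_def quotient_module_def)
  have \<pi>_deg: "degree_preserving_hom ?F0 M \<pi>"
    unfolding degree_preserving_hom_def using \<pi> component by simp
  \<comment> \<open>The kernel of \<open>\<pi>\<close> is the image of \<open>\<phi>\<close>, which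
    is stable under projections because \<open>\<phi>\<close> commutes with them. This lets the
    grading descend.\<close>
  have ker: "\<pi> (free_proj s b \<alpha> x) = \<zero>\<^bsub>M\<^esub>"
    if "x \<in> carrier ?F0" "\<pi> x = \<zero>\<^bsub>M\<^esub>" for \<alpha> x
  proof -
    have "x \<in> \<phi> ` carrier ?F1"
      unfolding exact using that by simp
    then obtain w where w: "w \<in> carrier ?F1" "x = \<phi> w"
      by (rule imageE) auto
    then have "free_proj s b \<alpha> x = \<phi> (free_proj l g \<alpha> w)"
      using degree_preserving_hom_proj[OF graded_module_free graded_module_free \<phi>] by simp
    then have "free_proj s b \<alpha> x \<in> \<phi> ` carrier ?F1"
      by simp
    then show ?thesis
      unfolding exact by simp
  qed
  have "graded_module M (\<lambda>\<alpha> y. \<pi> (free_proj s b \<alpha> (SOME x. x \<in> carrier ?F0 \<and> \<pi> x = y)))"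
    by (rule graded_module_image[OF graded_module_free M \<pi> surj component ker])
  then have graded: "multigraded_module M"
    by (rule graded_module.multigraded)
  have "finitely_generated M"
  proof (rule finitely_generated_image[OF module_free M \<pi> surj])
    show "unit_vec s i \<in> carrier ?F0" for i
      by simp
    show "\<exists>v. x = (\<Oplus>\<^bsub>?F0\<^esub>i\<in>{..<s}. v i \<odot>\<^bsub>?F0\<^esub> unit_vec s i)" if "x \<in> carrier ?F0" for x
      using that unfolding finsum_free_unit_vec by (intro exI[of _ "vec_index x"]) auto
  qed
  moreover have "squarefree_components M"
    using g b by (intro squarefree_components_cokernel[OF graded_module_free graded_module_free M \<phi> \<pi>
      component exact] squarefree_components_free)
  ultimately have sqf: "squarefree_module M"
    using graded unfolding squarefree_module_def squarefree_components_def by (intro conjI)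
  \<comment> \<open>Both sides are column \<open>j\<close> of \<open>A\<close>.\<close>
  have "\<phi> (unit_vec l j) =
      (\<Oplus>\<^bsub>?F0\<^esub>i \<in> {..<s}. A $$ (i, j) \<odot>\<^bsub>?F0\<^esub> unit_vec s i)" if "j < l" for j
    unfolding finsum_free_unit_vec \<phi>_def using A that by (intro eq_vecI) auto
  then have "has_presentation_matrix M A"
    unfolding has_presentation_matrix_def
    using A graded graded_module.multigraded[OF graded_module_free, of l g]
      graded_module.multigraded[OF graded_module_free, of s b]
      multigraded_basis_free[of l g] multigraded_basis_free[of s b] \<phi> \<pi>_deg exact surj
    by - (rule exI[of _ ?F1], rule exI[of _ ?F0], rule exI[of _ "unit_vec l"],
        rule exI[of _ "unit_vec s"], rule exI[of _ \<phi>], rule exI[of _ \<pi>], simp)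
  with sqf show ?thesis
    by (intro exI[of _ M] conjI)
qed

theorem corollary2p5:
  fixes A :: "('n::finite, 'k::field_char_0) mpoly mat"
  assumes "squarefree_matrix A"
  shows "\<exists>M :: ('n, 'k, ('n, 'k) mpoly vec set) mgmodule.
           squarefree_module M \<and> has_presentation_matrix M A"
proof -
  have terms: "is_term (A $$ (i, j))" if "i < dim_row A" "j < dim_col A" for i j
    using assms that by (simp add: squarefree_matrix_def multigraded_matrix_def)
  obtain \<gamma> \<beta> where sol: "solves_system A \<gamma> \<beta>"
    and "\<forall>j < dim_col A. \<forall>t. \<gamma> j t \<in> {0, 1}" "\<forall>i < dim_row A. \<forall>t. \<beta> i t \<in> {0, 1}"
    using assms unfolding squarefree_matrix_def by (elim conjE exE)
  then have \<gamma>: "\<And>j t. j < dim_col A \<Longrightarrow> \<gamma> j t \<in> {0, 1}"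
    and \<beta>: "\<And>i t. i < dim_row A \<Longrightarrow> \<beta> i t \<in> {0, 1}"
    by auto
  \<comment> \<open>Since \<open>'n\<close> is finite, every function on it has finite support and
    defines an exponent vector. At indices in range the values are 0 or 1, so \<open>nat\<close>
    preserves them.\<close>
  define g where "g = (\<lambda>j. Abs_poly_mapping (\<lambda>t. nat (\<gamma> j t)))"
  define b where "b = (\<lambda>i. Abs_poly_mapping (\<lambda>t. nat (\<beta> i t)))"
  have g: "Poly_Mapping.lookup (g j) t = nat (\<gamma> j t)" for j t
    by (simp add: g_def)
  have b: "Poly_Mapping.lookup (b i) t = nat (\<beta> i t)" for i t
    by (simp add: b_def)
  show ?thesis
  proof (rule cokernel_squarefree)
    show "A \<in> carrier_mat (dim_row A) (dim_col A)"
      by simp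
    show "Poly_Mapping.lookup (g j) t \<le> 1" if "j < dim_col A" for j t
      using \<gamma>[OF that, of t] by (auto simp: g)
    show "Poly_Mapping.lookup (b i) t \<le> 1" if "i < dim_row A" for i t
      using \<beta>[OF that, of t] by (auto simp: b)
    fix i j \<alpha>
    assume ij: "i < dim_row A" "j < dim_col A" and \<alpha>: "\<alpha> \<in> Poly_Mapping.keys (A $$ (i, j))"
    obtain c \<alpha>' where "A $$ (i, j) = Poly_Mapping.single \<alpha>' c"
      using terms[OF ij] by (auto simp: is_term_def)
    \<comment> \<open>The entry is a single term in which \<alpha> occurs, so its exponent is
      \<alpha> and its coefficient is nonzero; the system therefore has an equation for it.\<close>
    then have entry: "A $$ (i, j) = Poly_Mapping.single \<alpha> c" "c \<noteq> 0"
      using \<alpha> by (auto split: if_splits)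
    show "g j = b i + \<alpha>"
    proof (rule poly_mapping_eqI)
      fix t
      have "\<gamma> j t - \<beta> i t = int (Poly_Mapping.lookup \<alpha> t)"
        using sol ij entry by (simp add: solves_system_def)
      then show "Poly_Mapping.lookup (g j) t = Poly_Mapping.lookup (b i + \<alpha>) t"
        using \<gamma>[OF ij(2), of t] \<beta>[OF ij(1), of t] by (auto simp: g b lookup_add)
    qed
  qed
qed

end
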